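(* Let $\lambda$ be a nonzero real number and let $(a_n(\lambda))_{n\ge0}$ be any sequence of real numbers. Define the degenerate B-algorithm matrix $(a_{n,m}(\lambda))_{n,m\ge0}$ by $a_{0,m}(\lambda)=a_m(\lambda)$ for $m\ge0$ and \[ a_{n,m}(\lambda)=\big(m-(n-1)\lambda\big)a_{n-1,m}(\lambda)-(m+1)a_{n-1,m+1}(\lambda),\qquad n\ge1,\ m\ge0. \] For $n\ge0$ let $f_n(t|\lambda)=\sum_{m\ge0}a_{n,m}(\lambda)t^m$ (a formal power series in $t$). Then for every integer $n\ge0$, \[ f_{n}(t|\lambda)=\Big((t-1)\frac{d}{dt}\Big)_{n,\lambda}f_{0}(t|\lambda), \] where for an operator $X$ we write $(X)_{0,\lambda}=\mathrm{id}$ and $(X)_{n,\lambda}=X(X-\lambda)(X-2\lambda)\cdots(X-(n-1)\lambda)$ for $n\ge1$, with $X=(t-1)\frac{d}{dt}$ acting on formal power series in $t$.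
   Context: $\frac{d}{dt}$ denotes formal differentiation of power series, and $(t-1)\frac{d}{dt}$ means differentiate then multiply by $t-1$; the scalar $j\lambda$ in $X-j\lambda$ acts as multiplication by $j\lambda$. *)

theory Defs
  imports Complex_Main "HOL-Computational_Algebra.Formal_Power_Series"
begin

text \<open>In the second equation the row index is \<open>n + 1\<close>, so the coefficient
  \<open>m - (n - 1) lam\<close> of the usual recurrence (for row \<open>n \<ge> 1\<close>) reads \<open>m - n lam\<close>.\<close>

primrec degenerate_B_matrix :: "real \<Rightarrow> (nat \<Rightarrow> real) \<Rightarrow> nat \<Rightarrow> nat \<Rightarrow> real" where
  "degenerate_B_matrix lam a 0 = (\<lambda>m. a m)"
| "degenerate_B_matrix lam a (Suc n) = (\<lambda>m.
     (real m - real n * lam) * degenerate_B_matrix lam a n m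
       - real (m + 1) * degenerate_B_matrix lam a n (m + 1))"

definition row_fps :: "real \<Rightarrow> (nat \<Rightarrow> real) \<Rightarrow> nat \<Rightarrow> real fps" where
  "row_fps lam a n = Abs_fps (\<lambda>m. degenerate_B_matrix lam a n m)"

definition X_op :: "real fps \<Rightarrow> real fps" where
  "X_op f = (fps_X - 1) * fps_deriv f"

text \<open>The product \<open>X (X - lam) \<dots> (X - (n - 1) lam)\<close> of operators is composition, in the
  written order: the rightmost factor acts first.\<close>

primrec degenerate_falling ::
    "(real fps \<Rightarrow> real fps) \<Rightarrow> real \<Rightarrow> nat \<Rightarrow> real fps \<Rightarrow> real fps" where
  "degenerate_falling X lam 0 = id"
| "degenerate_falling X lam (Suc n) =
     degenerate_falling X lam n \<circ> (\<lambda>f. X f - fps_const (real n * lam) * f)"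

end

theory Submission
  imports Defs
begin

text \<open>Comparing coefficients, row \<open>n + 1\<close> is obtained from row \<open>n\<close> by applying \<open>X - n lam\<close>.
  This puts the newest factor leftmost, whereas the falling product puts it rightmost; the two
  agree because the factors \<open>X - c\<close> commute with each other.\<close>

text \<open>\<open>X_op\<close> is linear over constants, so both sides expand to
  \<open>X (X f) - (c + d) X f + c d f\<close>, symmetric in \<open>c\<close> and
  \<open>d\<close>.\<close>

lemma X_op_diff_const_commute:
  "X_op (X_op f - fps_const c * f) - fps_const d * (X_op f - fps_const c * f) =
   X_op (X_op f - fps_const d * f) - fps_const c * (X_op f - fps_const d * f)"
  by (simp add: X_op_def algebra_simps)

lemma degenerate_falling_X_op_commute:
  "degenerate_falling X_op lam n (X_op f - fps_const c * f) =
   X_op (degenerate_falling X_op lam n f) - fps_const c * degenerate_falling X_op lam n f"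
proof (induction n arbitrary: f)
  case 0
  show ?case by simp
next
  case (Suc n)
  show ?case
    \<comment> \<open>The newest factor acts first: \<open>X - c\<close> is swapped past it, then
      the hypothesis at the shifted argument carries \<open>X - c\<close> past the rest.\<close>
    using Suc.IH[of "X_op f - fps_const (real n * lam) * f"]
    by (simp only: degenerate_falling.simps o_apply X_op_diff_const_commute[of f c])
qed

lemma row_fps_Suc:
  "row_fps lam a (Suc n) =
   X_op (row_fps lam a n) - fps_const (real n * lam) * row_fps lam a n"
proof (rule fps_ext)
  fix m
  show "fps_nth (row_fps lam a (Suc n)) m =
      fps_nth (X_op (row_fps lam a n) - fps_const (real n * lam) * row_fps lam a n) m"
    \<comment> \<open>Multiplication by \<open>fps_X\<close> shifts indices and gives 0 at
      \<open>m = 0\<close>, hence the case split.\<close>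
    by (cases m) (simp_all add: row_fps_def X_op_def algebra_simps)
qed

theorem theorem2p2:
  fixes lam :: real and a :: "nat \<Rightarrow> real" and n :: nat
  assumes "lam \<noteq> 0"
  shows "row_fps lam a n = degenerate_falling X_op lam n (row_fps lam a 0)"
proof (induction n)
  case 0
  show ?case by simp
next
  case (Suc n)
  then show ?case
    by (simp add: row_fps_Suc[of lam a n] degenerate_falling_X_op_commute)
qed

end
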